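(* Let $\mathcal{C}_1\subseteq\mathbb{F}_{q^m}^n$ be a linear code, $\mathcal{C}_2\subsetneqq\mathcal{C}_1$ a subcode with $\dim\mathcal{C}_2=\dim\mathcal{C}_1-l$, $l\ge 1$, and $\psi:\mathbb{F}_{q^m}^l\to\mathcal{C}_1/\mathcal{C}_2$ a linear bijection. Let $S$ be uniformly distributed over $\mathbb{F}_{q^m}^l$ and, given $S$, let $X$ be uniformly distributed over the coset $\psi(S)$. For a nonempty subset $\mathcal{Z}\subseteq\{1,\dots,l\}$ let $$\mathcal{C}_{3,\mathcal{Z}}=\bigcup_{\substack{s\in\mathbb{F}_{q^m}^l:\ s_i=0\ \forall i\in\mathcal{Z}}}\psi(s)\ \subseteq\ \mathcal{C}_1 .$$ Then the universal maximum strength $\Omega$ of the scheme is $$\Omega=\min\{M_{R,1}(\mathcal{C}_{3,\mathcal{Z}}^\perp,\mathcal{C}_1^\perp)+|\mathcal{Z}| : \emptyset\ne\mathcal{Z}\subseteq\{1,\dots,l\}\}-2 .$$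
   Context: $\mathbb{F}_{q^m}$ is the degree-$m$ extension ($m\ge1$) of the finite field $\mathbb{F}_q$. Linear codes are $\mathbb{F}_{q^m}$-subspaces of the row space $\mathbb{F}_{q^m}^n$; dimensions are over $\mathbb{F}_{q^m}$; $\mathcal{C}^\perp$ is the dual code for the standard bilinear form. For a subspace $V\subseteq\mathbb{F}_{q^m}^n$ put $V^q=\{[v_1^q,\dots,v_n^q]: v\in V\}$, and let $\Gamma(\mathbb{F}_{q^m}^n)$ be the set of $\mathbb{F}_{q^m}$-subspaces $V\subseteq\mathbb{F}_{q^m}^n$ with $V=V^q$. For codes $\mathcal{D}_2\subsetneqq\mathcal{D}_1\subseteq\mathbb{F}_{q^m}^n$ and $0\le i\le\dim(\mathcal{D}_1/\mathcal{D}_2)$, the $i$-th relative generalized rank weight (RGRW) is $M_{R,i}(\mathcal{D}_1,\mathcal{D}_2)=\min\{\dim V: V\in\Gamma(\mathbb{F}_{q^m}^n),\ \dim(\mathcal{D}_1\cap V)-\dim(\mathcal{D}_2\cap V)\ge i\}$. For $\mathcal{Z}\subseteq\{1,\dots,l\}$ write $S_{\mathcal{Z}}=(S_i:i\in\mathcal{Z})$. The universal maximum strength is, for $S$ uniform and $X$ conditionally uniform on $\psi(S)$ given $S$, $$\Omega=\max\{\omega : I(S_{\mathcal{Z}};BX^{\rm T})=0\ \ \forall\mathcal{Z}\subseteq\{1,\dots,l\},\ \forall B\in\mathbb{F}_q^{(\omega-|\mathcal{Z}|+1)\times n}\},$$ where $\omega$ ranges over integers, $I$ is mutual information, and the condition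 is vacuous for those $\mathcal{Z}$ with $\omega-|\mathcal{Z}|+1\le 0$. *)

theory Defs
  imports "HOL-Probability.Probability"
begin

section \<open>Linear codes\<close>

text \<open>
  The extension field is a finite field type \<open>'a\<close>; its row space of length \<open>n\<close> is
  \<open>'a ^ 'n\<close>, with the library's \<open>vec.subspace\<close> and \<open>vec.dim\<close> over \<open>'a\<close>.
  The base field is a subset of \<open>'a\<close>.
\<close>

definition is_subfield :: "'a::field set \<Rightarrow> bool" where
  "is_subfield K \<longleftrightarrow> 0 \<in> K \<and> 1 \<in> K \<and>
     (\<forall>x\<in>K. \<forall>y\<in>K. x + y \<in> K \<and> x * y \<in> K) \<and> (\<forall>x\<in>K. - x \<in> K \<and> inverse x \<in> K)"

definition dot :: "'a::field ^ 'n \<Rightarrow> 'a ^ 'n \<Rightarrow> 'a" where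
  "dot x y = (\<Sum>j\<in>UNIV. x $ j * y $ j)"

definition dual_code :: "('a::field ^ 'n) set \<Rightarrow> ('a ^ 'n) set" where
  "dual_code C = {x. \<forall>c\<in>C. dot x c = 0}"

definition frob_image :: "nat \<Rightarrow> ('a::field ^ 'n) set \<Rightarrow> ('a ^ 'n) set" where
  "frob_image q V = (\<lambda>v. \<chi> j. (v $ j) ^ q) ` V"

definition Gamma :: "nat \<Rightarrow> ('a::field ^ 'n) set set" where
  "Gamma q = {V. vec.subspace V \<and> frob_image q V = V}"

definition RGRW :: "nat \<Rightarrow> nat \<Rightarrow> ('a::{field,finite} ^ 'n) set \<Rightarrow> ('a ^ 'n) set \<Rightarrow> nat" where
  "RGRW q i D1 D2 = Min {vec.dim V | V. V \<in> Gamma q \<and>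
     int (vec.dim (D1 \<inter> V)) - int (vec.dim (D2 \<inter> V)) \<ge> int i}"

section \<open>Nested coset coding\<close>

definition quotient_space :: "('a::field ^ 'n) set \<Rightarrow> ('a ^ 'n) set \<Rightarrow> ('a ^ 'n) set set" where
  "quotient_space C1 C2 = (\<lambda>x. x +o C2) ` C1"

text \<open>
  Cosets are added elementwise. The scalar multiple of a coset \<open>x + C2\<close> by \<open>a\<close> is
  \<open>a x + C2\<close>; adding \<open>C2\<close> to the elementwise multiple is needed for \<open>a = 0\<close>.
\<close>

definition linear_bij_quotient ::
  "('a::field ^ 'n) set \<Rightarrow> ('a ^ 'n) set \<Rightarrow> ('a ^ 'l \<Rightarrow> ('a ^ 'n) set) \<Rightarrow> bool" where
  "linear_bij_quotient C1 C2 \<psi> \<longleftrightarrow>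
     bij_betw \<psi> UNIV (quotient_space C1 C2) \<and>
     (\<forall>s t. \<psi> (s + t) = \<psi> s + \<psi> t) \<and>
     (\<forall>a s. \<psi> (a *s s) = (\<lambda>x. a *s x) ` \<psi> s + C2)"

definition C3 :: "('a::field ^ 'l \<Rightarrow> ('a ^ 'n) set) \<Rightarrow> 'l set \<Rightarrow> ('a ^ 'n) set" where
  "C3 \<psi> Z = (\<Union>s\<in>{s. \<forall>i\<in>Z. s $ i = 0}. \<psi> s)"

text \<open>Random variables \<open>S\<close>, \<open>X\<close> on \<open>M\<close>: \<open>S\<close> is uniform, and \<open>X\<close> given \<open>S = s\<close> is uniform on \<open>\<psi> s\<close>.\<close>

definition coset_coding ::
  "'w measure \<Rightarrow> ('a::{field,finite} ^ 'l \<Rightarrow> ('a ^ 'n) set) \<Rightarrow> ('w \<Rightarrow> 'a ^ 'l) \<Rightarrow> ('w \<Rightarrow> 'a ^ 'n) \<Rightarrow> bool" where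
  "coset_coding M \<psi> S X \<longleftrightarrow>
     prob_space M \<and>
     S \<in> measurable M (count_space UNIV) \<and> X \<in> measurable M (count_space UNIV) \<and>
     distr M (count_space UNIV) S = uniform_count_measure UNIV \<and>
     (\<forall>s x. \<P>(w in M. X w = x \<bar> S w = s) = indicator (\<psi> s) x / real (card (\<psi> s)))"

text \<open>
  Mutual information of two random variables with finite range, to the base \<open>b\<close>; this is the
  library's abbreviation \<open>\<I>(U ; V)\<close> written outside its locale.
\<close>

abbreviation mutual_info :: "real \<Rightarrow> 'w measure \<Rightarrow> ('w \<Rightarrow> 'u) \<Rightarrow> ('w \<Rightarrow> 'v) \<Rightarrow> real" where
  "mutual_info b M U V \<equiv>
     prob_space.mutual_information M b (count_space (U ` space M)) (count_space (V ` space M)) U V"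

text \<open>
  A matrix with a variable number of rows is given by the list of its rows, and \<open>B X\<^sup>T\<close> by the
  list of the entries of that column. The family \<open>(S\<^sub>i : i \<in> Z)\<close> is an extensional function on \<open>Z\<close>.
  Logarithms are taken to the base \<open>CARD('a)\<close>; the vanishing of mutual information
  does not depend on the base.
\<close>

definition matrices :: "'a set \<Rightarrow> nat \<Rightarrow> ('a ^ 'n) list set" where
  "matrices K r = {B. length B = r \<and> (\<forall>b\<in>set B. \<forall>j. b $ j \<in> K)}"

definition mat_app :: "('a::field ^ 'n) list \<Rightarrow> 'a ^ 'n \<Rightarrow> 'a list" where
  "mat_app B x = map (\<lambda>b. dot b x) B"

definition secure_at ::
  "'a::{field,finite} set \<Rightarrow> 'w measure \<Rightarrow> ('w \<Rightarrow> 'a ^ 'l) \<Rightarrow> ('w \<Rightarrow> 'a ^ 'n) \<Rightarrow> int \<Rightarrow> bool" where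
  "secure_at K M S X \<omega> \<longleftrightarrow>
     (\<forall>Z :: 'l set. \<omega> - int (card Z) + 1 > 0 \<longrightarrow>
       (\<forall>B \<in> matrices K (nat (\<omega> - int (card Z) + 1)).
          mutual_info (real CARD('a)) M (\<lambda>w. \<lambda>i\<in>Z. S w $ i) (\<lambda>w. mat_app B (X w)) = 0))"

definition universal_maximum_strength ::
  "'a::{field,finite} set \<Rightarrow> 'w measure \<Rightarrow> ('w \<Rightarrow> 'a ^ 'l) \<Rightarrow> ('w \<Rightarrow> 'a ^ 'n) \<Rightarrow> int" where
  "universal_maximum_strength K M S X = (GREATEST \<omega>. secure_at K M S X \<omega>)"

end

theory Submission
  imports Defs
begin

text \<open>
  For a matrix \<open>B\<close> over the base field with row space \<open>V\<close>, the variables \<open>S\<^sub>Z\<close> and \<open>B X\<close> are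
  independent iff \<open>B\<close> maps \<open>C3 Z\<close> onto the image of \<open>C1\<close>; dually, iff
  \<open>V \<inter> (C3 Z)\<^sup>\<bottom> \<subseteq> C1\<^sup>\<bottom>\<close>. By Galois descent the row spaces of matrices with \<open>r\<close> rows over the base field
  are exactly the Frobenius-stable spaces of dimension at most \<open>r\<close>. Hence \<open>r\<close> rows reveal something about
  \<open>S\<^sub>Z\<close> iff \<open>r\<close> is at least the first relative generalized rank weight, and the formula follows by
  comparing this with \<open>r = \<omega> - |Z| + 1\<close>.
\<close>

section \<open>The Frobenius map and Galois descent\<close>

text \<open>Multiplication by a nonzero \<open>x\<close> permutes the nonzero elements of
  \<open>K\<close>; comparing the product of these elements before and after gives
  \<open>x ^ (card K - 1) = 1\<close>.\<close>

lemma subfield_power_card: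
  fixes K :: "'a::{field,finite} set"
  assumes K: "is_subfield K" and x: "x \<in> K"
  shows "x ^ card K = x"
proof (cases "x = 0")
  case True
  have "card K > 0" using x by (auto simp: card_gt_0_iff)
  then show ?thesis using True by simp
next
  case False
  define L where "L = K - {0}"
  have inv: "inverse x \<in> K" and mult: "\<And>a b. a \<in> K \<Longrightarrow> b \<in> K \<Longrightarrow> a * b \<in> K"
    using K x by (auto simp: is_subfield_def)
  have "bij_betw ((*) x) L L"
    by (rule bij_betw_byWitness[where f' = "(*) (inverse x)"])
      (use False inv mult x in \<open>auto simp: L_def\<close>)
  then have "(\<Prod>y\<in>L. x * y) = \<Prod>L"
    by (rule prod.reindex_bij_betw)
  moreover have "(\<Prod>y\<in>L. x * y) = x ^ card L * \<Prod>L"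
    by (simp add: prod.distrib)
  moreover have "\<Prod>L \<noteq> 0"
    by (simp add: L_def)
  ultimately have "x ^ card L = 1" by simp
  moreover have "card K = Suc (card L)"
    unfolding L_def using K by (intro card_Suc_Diff1[symmetric]) (simp_all add: is_subfield_def)
  ultimately show ?thesis by simp
qed

lemma subfield_card_ge_2:
  fixes K :: "'a::{field,finite} set"
  assumes "is_subfield K"
  shows "card K \<ge> 2"
proof -
  have "card {0::'a, 1} \<le> card K"
    using assms by (intro card_mono) (auto simp: is_subfield_def)
  then show ?thesis by simp
qed

text \<open>The polynomial \<open>X^q - X\<close> with \<open>q = card K\<close> has at most
  \<open>q\<close> roots, and \<open>K\<close> already supplies \<open>q\<close> of them.\<close>

lemma subfield_eq_fixed_points:
  fixes K :: "'a::{field,finite} set"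
  assumes K: "is_subfield K"
  shows "K = {x. x ^ card K = x}"
proof -
  define p :: "'a poly" where "p = monom 1 (card K) - monom 1 1"
  note ge2 = subfield_card_ge_2[OF K]
  \<comment> \<open>Since \<open>card K\<close> is at least 2, the two monomials do not
    cancel.\<close>
  have "coeff p (card K) = 1"
    using ge2 by (simp add: p_def)
  then have "p \<noteq> 0" by auto
  moreover have "degree p \<le> card K"
    unfolding p_def using ge2
    by (intro degree_diff_le) (auto intro: order_trans[OF degree_monom_le])
  moreover have "{x. poly p x = 0} = {x. x ^ card K = x}"
    by (simp add: p_def poly_monom)
  ultimately have "card {x :: 'a. x ^ card K = x} \<le> card K"
    using card_poly_roots_bound[of p] by simp
  moreover have "K \<subseteq> {x. x ^ card K = x}"
    using subfield_power_card[OF K] by blast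
  ultimately show ?thesis
    by (intro card_seteq) auto
qed

text \<open>The polynomial \<open>(X + 1)\<^sup>q - X\<^sup>q - 1\<close> has degree less than \<open>q\<close> and vanishes on all \<open>q\<close>
  elements of the subfield, so it is zero.\<close>

lemma subfield_card_power_add:
  fixes K :: "'a::{field,finite} set"
  and x y :: 'a
  assumes K: "is_subfield K"
  shows "(x + y) ^ card K = x ^ card K + y ^ card K"
proof (cases "y = 0")
  case True
  then show ?thesis using subfield_card_ge_2[OF K] by simp
next
  case False
  define q where "q = card K"
  define p :: "'a poly" where "p = [:1, 1:] ^ q - monom 1 q - 1"
  have q: "q \<ge> 2" using subfield_card_ge_2[OF K] by (simp add: q_def)
  have deg: "degree ([:1, 1:] ^ q :: 'a poly) = q"
    by (simp add: degree_power_eq)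
  have top: "coeff ([:1, 1:] ^ q :: 'a poly) q = 1"
    using lead_coeff_power[of "[:1, 1:] :: 'a poly" q] by (simp add: deg)
  have "degree p \<le> q"
    unfolding p_def by (intro degree_diff_le) (auto simp: deg degree_monom_le)
  moreover have "coeff p q = 0"
    using q by (simp add: p_def top)
  ultimately have "p = 0 \<or> degree p < q"
    by (metis le_neq_implies_less leading_coeff_0_iff)
  moreover have "p = 0" if "degree p < q"
  proof (rule ccontr)
    assume "p \<noteq> 0"
    have "poly p z = 0" if "z \<in> K" for z
    proof -
      have "z + 1 \<in> K" using K that by (simp add: is_subfield_def)
      then show ?thesis
        using subfield_power_card[OF K] that
        by (simp add: p_def q_def poly_monom add.commute)
    qed
    then have "card K \<le> card {z. poly p z = 0}"
      by (intro card_mono) auto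
    then show False
      using card_poly_roots_bound[OF \<open>p \<noteq> 0\<close>] that by (simp add: q_def)
  qed
  \<comment> \<open>The one-variable identity is evaluated at \<open>x / y\<close> and then
    multiplied by \<open>y ^ q\<close>, which is why \<open>y = 0\<close> was treated apart.\<close>
  ultimately have "poly p (x / y) = 0" by auto
  then have "(x / y + 1) ^ q = (x / y) ^ q + 1"
    by (simp add: p_def poly_monom add.commute diff_eq_eq)
  moreover have "x + y = y * (x / y + 1)"
    using False by (simp add: field_simps)
  ultimately have "(x + y) ^ q = y ^ q * ((x / y) ^ q + 1)"
    by (metis power_mult_distrib)
  then show ?thesis
    using False by (simp add: q_def power_divide distrib_left)
qed

lemma subfield_card_power_diff:
  fixes K :: "'a::{field,finite} set"
  and x y :: 'a
  assumes "is_subfield K"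
  shows "(x - y) ^ card K = x ^ card K - y ^ card K"
  using subfield_card_power_add[OF assms, of "x - y" y] by simp

section \<open>Frobenius-stable subspaces and their rational vectors\<close>

definition frob :: "nat \<Rightarrow> 'a::field ^ 'n \<Rightarrow> 'a ^ 'n" where
  "frob q v = (\<chi> j. (v $ j) ^ q)"

lemma frob_nth [simp]: "frob q v $ j = (v $ j) ^ q"
  by (simp add: frob_def)

lemma frob_image_eq: "frob_image q V = frob q ` V"
  by (simp add: frob_image_def frob_def)

lemma frob_scale: "frob q (a *s v) = a ^ q *s frob q v"
  by (simp add: vec_eq_iff power_mult_distrib)

definition vectors_over :: "'a set \<Rightarrow> ('a ^ 'n) set" where
  "vectors_over K = {v. \<forall>j. v $ j \<in> K}"

context
  fixes K :: "'a::{field,finite} set"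
  assumes K: "is_subfield K"
begin

lemma frob_add:
  fixes v w :: "'a ^ 'n"
  shows "frob (card K) (v + w) = frob (card K) v + frob (card K) w"
  by (simp add: vec_eq_iff subfield_card_power_add[OF K])

text \<open>By additivity, vectors with equal images differ by a vector whose entries have power
  zero, and a field has no nonzero nilpotent.\<close>

lemma inj_frob: "inj (frob (card K) :: 'a ^ 'n \<Rightarrow> 'a ^ 'n)"
proof (rule injI)
  fix v w :: "'a ^ 'n"
  assume eq: "frob (card K) v = frob (card K) w"
  have "(v $ j - w $ j) ^ card K = 0" for j
    using arg_cong[OF eq, of "\<lambda>u. u $ j"] by (simp add: subfield_card_power_diff[OF K])
  then show "v = w" by (simp add: vec_eq_iff)
qed

lemma frob_eq_iff: "frob (card K) v = v \<longleftrightarrow> v \<in> vectors_over K"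
  using subfield_eq_fixed_points[OF K] by (auto simp: vec_eq_iff vectors_over_def)

text \<open>Stability in one direction suffices: the Frobenius map is injective and \<open>V\<close>
  is finite, so an image inside \<open>V\<close> is all of \<open>V\<close>.\<close>

lemma mem_GammaI:
  fixes V :: "('a ^ 'n) set"
  assumes V: "vec.subspace V" and sub: "\<And>v. v \<in> V \<Longrightarrow> frob (card K) v \<in> V"
  shows "V \<in> Gamma (card K)"
proof -
  have "card (frob (card K) ` V) = card V"
    using inj_frob by (metis card_image inj_on_subset subset_UNIV)
  then have "frob (card K) ` V = V"
    using sub by (intro card_subset_eq) auto
  then show ?thesis using V by (simp add: Gamma_def frob_image_eq)
qed

text \<open>The Frobenius map fixes the generators and is semilinear, so it only replaces the
  coefficients of a linear combination by their powers.\<close>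

lemma span_mem_Gamma:
  assumes "B \<subseteq> vectors_over K"
  shows "vec.span B \<in> Gamma (card K)"
proof (rule mem_GammaI)
  have 0: "card K > 0" using subfield_card_ge_2[OF K] by simp
  show "frob (card K) v \<in> vec.span B" if "v \<in> vec.span B" for v
    using that
  proof (induction rule: vec.span_induct_alt)
    case base
    have "frob (card K) (0 :: 'a ^ 'b) = 0" using 0 by (simp add: vec_eq_iff)
    then show ?case by (simp add: vec.span_zero)
  next
    case (step c x y)
    have "frob (card K) x = x" using step assms by (auto simp: frob_eq_iff)
    then show ?case
      using step by (simp add: frob_add frob_scale vec.span_add vec.span_scale vec.span_base)
  qed
qed simp

text \<open>A nonzero vector of minimal support, scaled to have an entry \<open>1\<close>, is fixed by the Frobenius
  map, since its difference with its image has smaller support. Subtracting a multiple of such a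
  vector shrinks the support of an arbitrary vector.\<close>

lemma Gamma_span_rational:
  fixes V :: "('a ^ 'n) set"
  assumes V: "V \<in> Gamma (card K)"
  shows "vec.span (V \<inter> vectors_over K) = V"
proof
  have sub: "vec.subspace V" and fr: "\<And>v. v \<in> V \<Longrightarrow> frob (card K) v \<in> V"
    using V by (auto simp: Gamma_def frob_image_eq)
  have 0: "card K > 0" using subfield_card_ge_2[OF K] by simp
  show "vec.span (V \<inter> vectors_over K) \<subseteq> V"
    by (simp add: vec.span_minimal sub)
  define supp :: "'a ^ 'n \<Rightarrow> 'n set" where "supp v = {j. v $ j \<noteq> 0}" for v
  have "v \<in> vec.span (V \<inter> vectors_over K)" if "v \<in> V" for v
    using that
  proof (induction "card (supp v)" arbitrary: v rule: less_induct)
    case less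
    show ?case
    proof (cases "v = 0")
      case True
      then show ?thesis by (simp add: vec.span_zero)
    next
      case False
      \<comment> \<open>Minimality is sought only among vectors supported inside
        \<open>supp v\<close>, so that subtracting a multiple of \<open>u\<close> from
        \<open>v\<close> cannot enlarge the support.\<close>
      define P where "P u \<longleftrightarrow> u \<in> V \<and> u \<noteq> 0 \<and> supp u \<subseteq> supp v" for u
      have "P v" using less.prems False by (simp add: P_def)
      then obtain u where u: "P u" and min: "\<And>w. P w \<Longrightarrow> card (supp u) \<le> card (supp w)"
        using ex_has_least_nat[of P v "\<lambda>u. card (supp u)"] by blast
      obtain j where j: "u $ j \<noteq> 0" using u by (auto simp: P_def vec_eq_iff)
      define w where "w = inverse (u $ j) *s u"
      have w: "w \<in> V" "w $ j = 1" "supp w = supp u"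
        using u j sub by (auto simp: w_def P_def supp_def vec.subspace_scale)
      define d where "d = frob (card K) w - w"
      have dV: "d \<in> V" using fr w sub by (simp add: d_def vec.subspace_diff)
      \<comment> \<open>Zero entries of \<open>w\<close> stay zero, and the entry 1 at
        \<open>j\<close> cancels against its own power.\<close>
      have "supp d \<subseteq> supp w - {j}" using w(2) 0 by (auto simp: d_def supp_def)
      moreover have "j \<in> supp w" using w(2) by (simp add: supp_def)
      ultimately have "supp d \<subset> supp u" using w(3) by blast
      then have "card (supp d) < card (supp u)"
        by (intro psubset_card_mono) auto
      moreover have "supp d \<subseteq> supp v"
        using \<open>supp d \<subset> supp u\<close> u by (auto simp: P_def)
      ultimately have "d = 0"
        using min[of d] dV by (auto simp: P_def)
      then have wK: "w \<in> vectors_over K" by (simp add: d_def flip: frob_eq_iff)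
      have jv: "j \<in> supp v" using u j by (auto simp: P_def supp_def)
      define v' where "v' = v - v $ j *s w"
      have "v' \<in> V" using less.prems w sub by (simp add: v'_def vec.subspace_diff vec.subspace_scale)
      moreover have "supp w \<subseteq> supp v" using w(3) u by (simp add: P_def)
      then have "supp v' \<subseteq> supp v - {j}"
        using w(2) by (auto simp: v'_def supp_def)
      then have "card (supp v') < card (supp v)"
        using jv by (intro psubset_card_mono) auto
      ultimately have "v' \<in> vec.span (V \<inter> vectors_over K)"
        using less.hyps by blast
      moreover have "v = v' + v $ j *s w" by (simp add: v'_def)
      ultimately show ?thesis
        using w wK by (metis IntI vec.span_add vec.span_base vec.span_scale)
    qed
  qed
  then show "V \<subseteq> vec.span (V \<inter> vectors_over K)" by blast
qed

text \<open>By descent the rational vectors of \<open>V\<close> span it, so a basis of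
  \<open>V\<close> can be chosen among them; its members serve as rows.\<close>

lemma Gamma_rows:
  fixes V :: "('a ^ 'n) set"
  assumes V: "V \<in> Gamma (card K)" and r: "vec.dim V \<le> r"
  obtains B where "B \<in> matrices K r" "vec.span (set B) = V"
proof -
  obtain b where b: "b \<subseteq> V \<inter> vectors_over K" "vec.independent b"
      "V \<inter> vectors_over K \<subseteq> vec.span b" "card b = vec.dim (V \<inter> vectors_over K)"
    using vec.basis_exists by blast
  have span: "vec.span b = V"
    using b Gamma_span_rational[OF V] by (metis vec.span_eq vec.span_superset subset_trans)
  have card: "card b = vec.dim V"
    using b(4) Gamma_span_rational[OF V] by (metis vec.dim_span)
  obtain bs where bs: "set bs = b" "length bs = card b"
    using finite_distinct_list[of b] distinct_card by (metis finite)
  \<comment> \<open>Zero rows bring the length to exactly \<open>r\<close> without changing the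
    span.\<close>
  define B where "B = bs @ replicate (r - card b) 0"
  have "set B \<subseteq> insert 0 b" "b \<subseteq> set B" using bs by (auto simp: B_def)
  then have "vec.span (set B) = V"
    using span by (metis vec.span_insert_0 vec.span_mono subset_antisym)
  moreover have "B \<in> matrices K r"
    using bs b(1) K card r by (auto simp: B_def matrices_def vectors_over_def is_subfield_def)
  ultimately show ?thesis by (rule that[rotated])
qed

end

section \<open>Duality\<close>

lemma dot_commute: "dot x y = dot y x"
  by (simp add: dot_def mult.commute)

lemma dot_add_left: "dot (x + y) z = dot x z + dot y z"
  by (simp add: dot_def algebra_simps sum.distrib)

lemma dot_add_right: "dot z (x + y) = dot z x + dot z y"
  by (simp add: dot_def algebra_simps sum.distrib)

lemma dot_diff_right: "dot z (x - y) = dot z x - dot z y"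
  by (simp add: dot_def algebra_simps sum_subtractf)

lemma dot_scale_left: "dot (a *s x) z = a * dot x z"
  by (simp add: dot_def sum_distrib_left mult.assoc)

lemma dot_zero_left [simp]: "dot 0 z = 0"
  by (simp add: dot_def)

lemma subspace_dual_code: "vec.subspace (dual_code C)"
  by (auto simp: vec.subspace_def dual_code_def dot_add_left dot_scale_left)

lemma dual_code_antimono: "C \<subseteq> D \<Longrightarrow> dual_code D \<subseteq> dual_code C"
  by (auto simp: dual_code_def)

text \<open>A linear map that vanishes on a basis of \<open>D\<close> but not at \<open>x\<close>
  exists because \<open>x\<close> extends that basis; a row of its matrix is the required dual
  word.\<close>

lemma dual_code_separates:
  fixes D :: "('a::field ^ 'n) set"
  assumes D: "vec.subspace D" and x: "x \<notin> D"
  obtains y where "y \<in> dual_code D" "dot y x \<noteq> 0"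
proof -
  obtain b where b: "b \<subseteq> D" "vec.independent b" "D \<subseteq> vec.span b"
    using vec.basis_exists[of D] by metis
  have span: "vec.span b = D" using b D by (metis vec.span_subspace)
  have "vec.independent (insert x b)"
    using b x span by (simp add: vec.independent_insert)
  from vec.linear_independent_extend[OF this, of "\<lambda>z. if z = x then 1 else 0"]
  obtain f :: "'a ^ 'n \<Rightarrow> 'a ^ 'n" where f: "Vector_Spaces.linear (*s) (*s) f"
      "\<And>z. z \<in> insert x b \<Longrightarrow> f z = (if z = x then 1 else 0)"
    by blast
  \<comment> \<open>The map \<open>f\<close> sends \<open>x\<close> to the all-one vector, so every
    coordinate of \<open>f\<close> is a separating functional and the choice of \<open>i\<close> is
    arbitrary.\<close>
  define i :: 'n where "i = undefined"
  define y where "y = matrix f $ i"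
  have dot: "dot y z = f z $ i" for z
  proof -
    have "dot y z = (matrix f *v z) $ i"
      by (simp only: y_def dot_def matrix_vector_mult_def vec_lambda_beta)
    then show ?thesis by (simp only: matrix_works[OF f(1)])
  qed
  have "x \<notin> b" using x b by blast
  then have "f z = 0" if "z \<in> b" for z using f that by auto
  then have "f z = 0" if "z \<in> D" for z
    using vec.linear_eq_0_on_span[OF f(1)] that span by blast
  then have "y \<in> dual_code D" by (simp add: dual_code_def dot)
  moreover have "dot y x \<noteq> 0" using f by (simp add: dot)
  ultimately show ?thesis by (rule that)
qed

lemma subset_dual_dual_code: "D \<subseteq> dual_code (dual_code D)"
  by (auto simp: dual_code_def dot_commute)

lemma dual_dual_code:
  assumes "vec.subspace D"
  shows "dual_code (dual_code D) = D"
proof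
  show "D \<subseteq> dual_code (dual_code D)" by (rule subset_dual_dual_code)
  show "dual_code (dual_code D) \<subseteq> D"
  proof
    fix x assume x: "x \<in> dual_code (dual_code D)"
    show "x \<in> D"
    proof (rule ccontr)
      assume "x \<notin> D"
      then obtain y where "y \<in> dual_code D" and "dot y x \<noteq> 0"
        using dual_code_separates assms by blast
      then have "dot x y = 0" using x by (simp add: dual_code_def)
      then show False using \<open>dot y x \<noteq> 0\<close> by (simp add: dot_commute)
    qed
  qed
qed

lemma dual_code_plus:
  assumes "0 \<in> C" "0 \<in> D"
  shows "dual_code (C + D) = dual_code C \<inter> dual_code D"
proof -
  have "C \<subseteq> C + D" "D \<subseteq> C + D"
    using assms by (auto simp: set_plus_def) force+
  then show ?thesis
    by (auto simp: dual_code_def set_plus_def dot_add_right) blast+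
qed

section \<open>Kernels and images of matrices in terms of dual codes\<close>

text \<open>The kernel of \<open>mat_app B\<close> is the dual of the row space, since orthogonality
  to the rows passes to their linear combinations.\<close>

lemma mat_app_eq_iff:
  "mat_app B x = mat_app B y \<longleftrightarrow> x - y \<in> dual_code (vec.span (set B))"
proof -
  have "mat_app B x = mat_app B y \<longleftrightarrow> (\<forall>b\<in>set B. dot b (x - y) = 0)"
    by (simp add: mat_app_def dot_diff_right)
  also have "\<dots> \<longleftrightarrow> (\<forall>b\<in>vec.span (set B). dot b (x - y) = 0)"
  proof (intro iffI ballI)
    fix b assume *: "\<forall>b\<in>set B. dot b (x - y) = 0" and "b \<in> vec.span (set B)"
    show "dot b (x - y) = 0"
      using \<open>b \<in> vec.span (set B)\<close>
      by (induction rule: vec.span_induct_alt) (use * in \<open>simp_all add: dot_add_left dot_scale_left\<close>)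
  qed (simp add: vec.span_base)
  finally show ?thesis by (simp add: dual_code_def dot_commute)
qed

text \<open>With \<open>V\<close> the row space, the kernel of \<open>B\<close> is the dual of
  \<open>V\<close>, so the left side says that \<open>D\<close> lies in \<open>C\<close> plus this
  dual. Taking duals turns the sum into an intersection and reverses the inclusion.\<close>

lemma mat_app_image_subset_iff:
  fixes C D :: "('a::field ^ 'n) set"
  assumes C: "vec.subspace C"
  shows "mat_app B ` D \<subseteq> mat_app B ` C \<longleftrightarrow>
    dual_code C \<inter> vec.span (set B) \<subseteq> dual_code D"
proof -
  define V where "V = vec.span (set B)"
  have V: "vec.subspace V" by (simp add: V_def)
  have sum: "vec.subspace (C + dual_code V)"
    unfolding set_plus_def using vec.subspace_sums[OF C subspace_dual_code[of V]]
    by (simp add: Bex_def conj_commute conj_left_commute)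
  have 0: "0 \<in> C" "0 \<in> dual_code V"
    using C subspace_dual_code by (auto intro: vec.subspace_0)
  have "mat_app B ` D \<subseteq> mat_app B ` C \<longleftrightarrow> D \<subseteq> C + dual_code V"
  proof -
    have "(\<exists>c\<in>C. x - c \<in> dual_code V) \<longleftrightarrow> x \<in> C + dual_code V" for x
    proof
      assume "\<exists>c\<in>C. x - c \<in> dual_code V"
      then obtain c where "c \<in> C" "x - c \<in> dual_code V" by blast
      then have "c + (x - c) \<in> C + dual_code V" by (rule set_plus_intro)
      then show "x \<in> C + dual_code V" by simp
    next
      assume "x \<in> C + dual_code V"
      then obtain c d where "c \<in> C" "d \<in> dual_code V" "x = c + d" by (auto simp: set_plus_def)
      then show "\<exists>c\<in>C. x - c \<in> dual_code V" by (intro bexI[of _ c]) simp_all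
    qed
    then show ?thesis by (simp add: image_subset_iff image_iff mat_app_eq_iff subset_eq flip: V_def)
  qed
  also have "\<dots> \<longleftrightarrow> dual_code (C + dual_code V) \<subseteq> dual_code D"
  proof
    \<comment> \<open>Dualizing once more recovers the inclusion: the sum is a subspace and equals
      its bidual, while \<open>D\<close> is contained in its own.\<close>
    assume "dual_code (C + dual_code V) \<subseteq> dual_code D"
    then have "dual_code (dual_code D) \<subseteq> C + dual_code V"
      using dual_code_antimono dual_dual_code[OF sum] by metis
    moreover have "D \<subseteq> dual_code (dual_code D)"
      by (rule subset_dual_dual_code)
    ultimately show "D \<subseteq> C + dual_code V" by (rule subset_trans[rotated])
  qed (rule dual_code_antimono)
  also have "dual_code (C + dual_code V) = dual_code C \<inter> V"
    by (simp add: dual_code_plus[OF 0] dual_dual_code[OF V])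
  finally show ?thesis by (simp add: V_def)
qed

section \<open>Vanishing of mutual information\<close>

text \<open>Mutual information is the divergence of the joint law \<open>Q\<close> from the product
  \<open>P\<close> of the marginals, and it vanishes only for \<open>Q = P\<close>. The regularity
  required for this (absolute continuity, an integrable density) comes from the finite
  ranges.\<close>

lemma (in information_space) mutual_information_eq_0_iff_simple:
  assumes U: "simple_function M U" and V: "simple_function M V"
  shows "\<I>(U ; V) = 0 \<longleftrightarrow>
    (\<forall>u\<in>U ` space M. \<forall>v\<in>V ` space M.
      \<P>(w in M. U w = u \<and> V w = v) = \<P>(w in M. U w = u) * \<P>(w in M. V w = v))"
    (is "?L \<longleftrightarrow> ?R")
proof
  define A where "A = count_space (U ` space M)"
  define B where "B = count_space (V ` space M)"
  define P where "P = distr M A U \<Otimes>\<^sub>M distr M B V"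
  define Q where "Q = distr M (A \<Otimes>\<^sub>M B) (\<lambda>w. (U w, V w))"
  have fin: "finite (U ` space M)" "finite (V ` space M)"
    using U V by (auto simp: simple_function_def)
  have meas: "U \<in> measurable M A" "V \<in> measurable M B"
    using simple_functionD[OF U] simple_functionD[OF V] fin
    by (auto simp: A_def B_def measurable_count_space_eq2)
  have AB: "A \<Otimes>\<^sub>M B = count_space (U ` space M \<times> V ` space M)"
    unfolding A_def B_def using fin by (rule pair_measure_count_space)
  have sets_AB: "sets (A \<Otimes>\<^sub>M B) = Pow (U ` space M \<times> V ` space M)"
    unfolding AB by simp
  have pair: "(\<lambda>w. (U w, V w)) \<in> measurable M (A \<Otimes>\<^sub>M B)"
    using meas by measurable
  interpret DA: prob_space "distr M A U" using meas(1) by (rule prob_space_distr)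
  interpret DB: prob_space "distr M B V" using meas(2) by (rule prob_space_distr)
  interpret P: pair_prob_space "distr M A U" "distr M B V" ..
  interpret P: information_space P b
    unfolding P_def by standard (rule b_gt_1)
  interpret Q: prob_space Q unfolding Q_def using pair by (rule prob_space_distr)
  have "sets P = sets (A \<Otimes>\<^sub>M B)"
    unfolding P_def by (intro sets_pair_measure_cong) simp_all
  then have sets_P: "sets P = Pow (U ` space M \<times> V ` space M)"
    by (simp add: sets_AB)
  have sets_Q: "sets Q = Pow (U ` space M \<times> V ` space M)"
    by (simp add: Q_def sets_AB)
  have Qmeas: "measure Q {(u, v)} = \<P>(w in M. U w = u \<and> V w = v)"
    if "u \<in> U ` space M" "v \<in> V ` space M" for u v
  proof -
    have "measure Q {(u, v)} = prob ((\<lambda>w. (U w, V w)) -` {(u, v)} \<inter> space M)"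
      unfolding Q_def using pair by (rule measure_distr) (use that in \<open>auto simp: sets_AB\<close>)
    also have "(\<lambda>w. (U w, V w)) -` {(u, v)} \<inter> space M = {w \<in> space M. U w = u \<and> V w = v}"
      by auto
    finally show ?thesis .
  qed
  have Ameas: "measure (distr M A U) {u} = \<P>(w in M. U w = u)" if "u \<in> U ` space M" for u
    using that meas by (subst measure_distr) (auto simp: A_def intro!: arg_cong[where f = prob])
  have Bmeas: "measure (distr M B V) {v} = \<P>(w in M. V w = v)" if "v \<in> V ` space M" for v
    using that meas by (subst measure_distr) (auto simp: B_def intro!: arg_cong[where f = prob])
  have Pmeas: "emeasure P {(u, v)} = ennreal (\<P>(w in M. U w = u) * \<P>(w in M. V w = v))"
    if "u \<in> U ` space M" "v \<in> V ` space M" for u v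
  proof -
    have "emeasure P ({u} \<times> {v}) = emeasure (distr M A U) {u} * emeasure (distr M B V) {v}"
      unfolding P_def using that by (intro DB.emeasure_pair_measure_Times) (auto simp: A_def B_def)
    then show ?thesis
      using that by (simp add: DA.emeasure_eq_measure DB.emeasure_eq_measure Ameas Bmeas ennreal_mult)
  qed
  show ?R if L: ?L
  proof (intro ballI)
    fix u v assume uv: "u \<in> U ` space M" "v \<in> V ` space M"
    \<comment> \<open>A point of product mass zero has a marginal of probability zero, which bounds
      its joint probability; null sets are finite unions of such points.\<close>
    have "absolutely_continuous P Q"
      unfolding absolutely_continuous_def
    proof
      fix N assume N: "N \<in> null_sets P"
      then have sub: "N \<subseteq> U ` space M \<times> V ` space M" using sets_P by (auto simp: null_sets_def)
      have "measure Q {z} = 0" if z: "z \<in> N" for z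
      proof -
        obtain u v where uv: "z = (u, v)" "u \<in> U ` space M" "v \<in> V ` space M"
          using z sub by auto
        have "emeasure P {z} \<le> emeasure P N"
          using z N by (intro emeasure_mono) auto
        then have "\<P>(w in M. U w = u) * \<P>(w in M. V w = v) = 0"
          using N uv Pmeas[of u v] by (auto simp: null_sets_def ennreal_eq_0_iff mult_le_0_iff measure_le_0_iff)
        moreover have "{w \<in> space M. U w = u} \<in> events" "{w \<in> space M. V w = v} \<in> events"
          using simple_functionD(2)[OF U, of "{u}"] simple_functionD(2)[OF V, of "{v}"]
          by (auto simp: vimage_def Int_def conj_commute)
        then have "\<P>(w in M. U w = u \<and> V w = v) \<le> \<P>(w in M. U w = u)"
          "\<P>(w in M. U w = u \<and> V w = v) \<le> \<P>(w in M. V w = v)"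
          by (auto intro!: finite_measure_mono)
        ultimately show ?thesis
          using uv Qmeas[of u v] by (auto simp: measure_le_0_iff)
      qed
      moreover have "finite N" using sub fin by (meson finite_SigmaI finite_subset)
      moreover have "measure Q N = (\<Sum>z\<in>N. measure Q {z})"
        using \<open>finite N\<close> sub sets_Q by (intro Q.finite_measure_eq_sum_singleton) auto
      ultimately have "measure Q N = 0" by simp
      then show "N \<in> null_sets Q"
        using sub sets_Q by (simp add: null_sets_def Q.emeasure_eq_measure)
    qed
    \<comment> \<open>On a finite space with all subsets measurable, every real function is
      measurable and bounded by the sum of its absolute values.\<close>
    moreover have "integrable Q (entropy_density b P Q)"
    proof -
      have space: "space Q = U ` space M \<times> V ` space M"
        using sets_Q sets_eq_imp_space_eq[of Q "count_space (U ` space M \<times> V ` space M)"] by simp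
      then have "finite (space Q)" using fin by simp
      then have bound: "norm (entropy_density b P Q z) \<le> (\<Sum>z\<in>space Q. norm (entropy_density b P Q z))"
        if "z \<in> space Q" for z
        using that by (intro member_le_sum) auto
      have "entropy_density b P Q \<in> borel_measurable Q"
        using sets_Q space by (intro measurableI) auto
      then show ?thesis
        using bound
        by (intro Q.integrable_const_bound[where B = "\<Sum>z\<in>space Q. norm (entropy_density b P Q z)"]) (auto intro!: AE_I2)
    qed
    moreover have "KL_divergence b P Q = 0"
      using L by (simp add: mutual_information_def P_def Q_def A_def B_def)
    moreover have "sets P = sets Q" by (simp add: sets_P sets_Q)
    ultimately have "Q = P"
      using P.KL_eq_0_iff_eq_ac[OF Q.prob_space_axioms] by blast
    then show "\<P>(w in M. U w = u \<and> V w = v) = \<P>(w in M. U w = u) * \<P>(w in M. V w = v)"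
      using Qmeas[OF uv] Pmeas[OF uv] by (simp add: measure_def)
  qed
next
  assume R: ?R
  have UV: "simple_function M (\<lambda>w. (U w, V w))"
    using U V by (rule simple_function_Pair)
  define Pu where "Pu = (\<lambda>u. \<P>(w in M. U w = u))"
  define Pv where "Pv = (\<lambda>v. \<P>(w in M. V w = v))"
  define Puv where "Puv = (\<lambda>(u, v). \<P>(w in M. U w = u \<and> V w = v))"
  show ?L
  proof (rule mutual_information_eq_0_simple)
    show "simple_distributed M U Pu" "simple_distributed M V Pv"
      by (rule simple_distributedI; use U V in \<open>auto simp: Pu_def Pv_def intro!: arg_cong[where f = prob]\<close>)+
    show "simple_distributed M (\<lambda>w. (U w, V w)) Puv"
      by (rule simple_distributedI; use UV in \<open>auto simp: Puv_def intro!: arg_cong[where f = prob]\<close>)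
    show "\<forall>w\<in>space M. Puv (U w, V w) = Pu (U w) * Pv (V w)"
      using R by (auto simp: Pu_def Pv_def Puv_def)
  qed
qed

lemma (in prob_space) prob_eq_sum_simple:
  assumes U: "simple_function M U" and V: "simple_function M V"
  shows "\<P>(w in M. V w = v) = (\<Sum>u\<in>U ` space M. \<P>(w in M. U w = u \<and> V w = v))"
proof -
  have [measurable]: "{w \<in> space M. U w = u} \<in> events" "{w \<in> space M. V w = v} \<in> events" for u v
    using simple_functionD(2)[OF U, of "{u}"] simple_functionD(2)[OF V, of "{v}"]
    by (auto simp: vimage_def Int_def conj_commute)
  have "(\<Sum>u\<in>U ` space M. \<P>(w in M. U w = u \<and> V w = v)) =
      prob (\<Union>u\<in>U ` space M. {w \<in> space M. U w = u \<and> V w = v})"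
    using simple_functionD(1)[OF U]
    by (intro finite_measure_finite_Union[symmetric]) (auto simp: disjoint_family_on_def)
  also have "(\<Union>u\<in>U ` space M. {w \<in> space M. U w = u \<and> V w = v}) = {w \<in> space M. V w = v}"
    by auto
  finally show ?thesis by simp
qed

text \<open>Let \<open>U\<close> take \<open>n\<close> values. Summing the constant joint
  probability over them gives \<open>P(V = v) = n * P(U = u, V = v)\<close>; summing this over
  \<open>v\<close> shows that \<open>U\<close> is uniform, with
  \<open>P(U = u) = 1 / n\<close>.\<close>

lemma (in prob_space) indep_if_joint_prob_const:
  assumes U: "simple_function M U" and V: "simple_function M V"
    and const: "\<And>u u' v. u \<in> U ` space M \<Longrightarrow> u' \<in> U ` space M \<Longrightarrow>
      \<P>(w in M. U w = u \<and> V w = v) = \<P>(w in M. U w = u' \<and> V w = v)"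
    and u: "u \<in> U ` space M"
  shows "\<P>(w in M. U w = u \<and> V w = v) = \<P>(w in M. U w = u) * \<P>(w in M. V w = v)"
proof -
  define n where "n = real (card (U ` space M))"
  have V_eq: "\<P>(w in M. V w = v) = n * \<P>(w in M. U w = u \<and> V w = v)" for v
  proof -
    have "\<P>(w in M. V w = v) = (\<Sum>_\<in>U ` space M. \<P>(w in M. U w = u \<and> V w = v))"
      unfolding prob_eq_sum_simple[OF U V] by (intro sum.cong refl const u)
    then show ?thesis by (simp add: n_def)
  qed
  have U_eq: "\<P>(w in M. U w = u) = (\<Sum>v\<in>V ` space M. \<P>(w in M. U w = u \<and> V w = v))"
    using prob_eq_sum_simple[OF V U, of u] by (simp add: conj_commute)
  have "n * \<P>(w in M. U w = u) = (\<Sum>v\<in>V ` space M. \<P>(w in M. V w = v))"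
    by (simp add: U_eq V_eq sum_distrib_left)
  \<comment> \<open>Total probability applied to a constant second variable: the probabilities of
    the values of \<open>V\<close> add up to 1.\<close>
  also have "\<dots> = 1"
    using prob_eq_sum_simple[OF V simple_function_const[of M "()"], of "()"] prob_space by simp
  finally have "n * \<P>(w in M. U w = u) = 1" .
  then have "\<P>(w in M. U w = u) * (n * p) = p" for p
    by (metis mult.assoc mult.commute mult_1_left)
  then show ?thesis unfolding V_eq by (rule sym)
qed

lemma mutual_info_eq_0_iff:
  assumes "prob_space M" "b > 1" "simple_function M U" "simple_function M V"
  shows "mutual_info b M U V = 0 \<longleftrightarrow>
    (\<forall>u\<in>U ` space M. \<forall>v\<in>V ` space M.
      \<P>(w in M. U w = u \<and> V w = v) = \<P>(w in M. U w = u) * \<P>(w in M. V w = v))"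
proof -
  interpret prob_space M by fact
  interpret information_space M b by standard fact
  show ?thesis using assms by (intro mutual_information_eq_0_iff_simple)
qed

section \<open>Nested coset coding\<close>

locale coset_scheme =
  fixes C1 C2 :: "('a::{field,finite} ^ 'n) set" and \<psi> :: "'a ^ 'l \<Rightarrow> ('a ^ 'n) set"
  assumes C1: "vec.subspace C1" and C2: "vec.subspace C2" and C2_subset: "C2 \<subseteq> C1"
    and psi: "linear_bij_quotient C1 C2 \<psi>"
begin

lemma psi_subset: "\<psi> s \<subseteq> C1"
proof -
  have "\<psi> s \<in> quotient_space C1 C2"
    using psi by (auto simp: linear_bij_quotient_def bij_betw_def)
  then show ?thesis
    using C2_subset
    by (auto simp: quotient_space_def elt_set_plus_def intro!: vec.subspace_add[OF C1])
qed

lemma psi_nonempty: obtains x where "x \<in> \<psi> s"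
proof -
  have "\<psi> s \<in> quotient_space C1 C2"
    using psi by (auto simp: linear_bij_quotient_def bij_betw_def)
  then obtain x where "\<psi> s = x +o C2" by (auto simp: quotient_space_def)
  then have "x + 0 \<in> \<psi> s" using vec.subspace_0[OF C2] by (simp only: set_plus_intro2)
  then show ?thesis by (rule that)
qed

lemma psi_coset:
  assumes "x \<in> \<psi> s"
  shows "\<psi> s = x +o C2"
proof -
  have "\<psi> s \<in> quotient_space C1 C2"
    using psi by (auto simp: linear_bij_quotient_def bij_betw_def)
  then obtain y where y: "\<psi> s = y +o C2" by (auto simp: quotient_space_def)
  then obtain c where c: "c \<in> C2" "x = y + c" using assms by (auto simp: elt_set_plus_def)
  have "y +o C2 \<subseteq> x +o C2"
  proof
    fix z assume "z \<in> y +o C2"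
    then obtain d where "d \<in> C2" "z = y + d" by (auto simp: elt_set_plus_def)
    then have "d - c \<in> C2" "z = x + (d - c)" using c C2 by (simp_all add: vec.subspace_diff)
    then show "z \<in> x +o C2" by (auto simp: elt_set_plus_def)
  qed
  moreover have "x +o C2 \<subseteq> y +o C2"
    using c C2 by (auto simp: elt_set_plus_def add.assoc intro: vec.subspace_add)
  ultimately show ?thesis using y by blast
qed

lemma psi_cover:
  assumes "x \<in> C1"
  obtains s where "x \<in> \<psi> s"
proof -
  have "x +o C2 \<in> range \<psi>"
    using psi assms by (auto simp: linear_bij_quotient_def bij_betw_def quotient_space_def)
  then obtain s where s: "\<psi> s = x +o C2" by auto
  have "x + 0 \<in> x +o C2" using vec.subspace_0[OF C2] by (rule set_plus_intro2)
  then show ?thesis using that[of s] s by simp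
qed

lemma psi_unique:
  assumes "x \<in> \<psi> s" "x \<in> \<psi> t"
  shows "s = t"
proof -
  have "inj \<psi>" using psi by (simp add: linear_bij_quotient_def bij_betw_def)
  moreover have "\<psi> s = \<psi> t" by (rule trans[OF psi_coset[OF assms(1)] psi_coset[OF assms(2), symmetric]])
  ultimately show ?thesis by (rule injD)
qed

lemma psi_add:
  assumes "x \<in> \<psi> s" "y \<in> \<psi> t"
  shows "x + y \<in> \<psi> (s + t)"
proof -
  have "\<psi> (s + t) = \<psi> s + \<psi> t" using psi by (simp add: linear_bij_quotient_def)
  then show ?thesis using assms by (simp add: set_plus_intro)
qed

lemma psi_scale:
  assumes "x \<in> \<psi> s"
  shows "a *s x \<in> \<psi> (a *s s)"
proof -
  have "\<psi> (a *s s) = (\<lambda>x. a *s x) ` \<psi> s + C2" using psi by (simp add: linear_bij_quotient_def)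
  moreover have "a *s x + 0 \<in> (\<lambda>x. a *s x) ` \<psi> s + C2"
    using assms vec.subspace_0[OF C2] by (intro set_plus_intro) auto
  ultimately show ?thesis by simp
qed

lemma psi_diff:
  assumes "x \<in> \<psi> s" "y \<in> \<psi> t"
  shows "x - y \<in> \<psi> (s - t)"
proof -
  have "x + (- 1) *s y \<in> \<psi> (s + (- 1) *s t)"
    using assms by (intro psi_add psi_scale)
  moreover have "x + (- 1) *s y = x - y" "s + (- 1) *s t = s - t" by (simp_all add: vec_eq_iff)
  ultimately show ?thesis by simp
qed

lemma mem_C3_iff: "x \<in> C3 \<psi> Z \<longleftrightarrow> (\<exists>s. (\<forall>i\<in>Z. s $ i = 0) \<and> x \<in> \<psi> s)"
  by (auto simp: C3_def)

lemma C3_subset: "C3 \<psi> Z \<subseteq> C1"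
  using psi_subset by (auto simp: C3_def)

text \<open>With no coordinate constrained the union runs over all cosets. This settles the empty
  index set, which occurs in \<open>secure_at\<close> but not in the minimum.\<close>

lemma C3_empty: "C3 \<psi> {} = C1"
proof
  show "C1 \<subseteq> C3 \<psi> {}"
  proof
    fix x assume "x \<in> C1"
    then obtain s where "x \<in> \<psi> s" by (rule psi_cover)
    then show "x \<in> C3 \<psi> {}" by (auto simp: mem_C3_iff)
  qed
qed (rule C3_subset)

lemma subspace_C3: "vec.subspace (C3 \<psi> Z)"
  unfolding vec.subspace_def
proof (intro conjI ballI allI)
  obtain x where "x \<in> \<psi> 0" by (rule psi_nonempty)
  \<comment> \<open>Subtracting an element of \<open>\<psi> 0\<close> from itself shows that this
    coset contains the zero vector.\<close>
  then have "x - x \<in> \<psi> (0 - 0)" by (intro psi_diff)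
  then show "0 \<in> C3 \<psi> Z" by (auto simp: mem_C3_iff intro!: exI[of _ 0])
next
  fix x y assume "x \<in> C3 \<psi> Z" "y \<in> C3 \<psi> Z"
  then obtain s t where "\<forall>i\<in>Z. s $ i = 0" "x \<in> \<psi> s" "\<forall>i\<in>Z. t $ i = 0" "y \<in> \<psi> t"
    by (auto simp: mem_C3_iff)
  then show "x + y \<in> C3 \<psi> Z"
    unfolding mem_C3_iff by (intro exI[of _ "s + t"]) (simp add: psi_add)
next
  fix a x assume "x \<in> C3 \<psi> Z"
  then obtain s where "\<forall>i\<in>Z. s $ i = 0" "x \<in> \<psi> s"
    by (auto simp: mem_C3_iff)
  then show "a *s x \<in> C3 \<psi> Z"
    unfolding mem_C3_iff by (intro exI[of _ "a *s s"]) (simp add: psi_scale)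
qed

text \<open>The message \<open>1\<close> is the all-one vector, with no zero coordinate, and a word
  of its coset belongs to no other coset. The strictness makes the relative weight a minimum over a
  nonempty set.\<close>

lemma C3_not_superset:
  assumes "Z \<noteq> {}"
  shows "\<not> C1 \<subseteq> C3 \<psi> Z"
proof
  assume sup: "C1 \<subseteq> C3 \<psi> Z"
  obtain x where x: "x \<in> \<psi> 1" by (rule psi_nonempty)
  then have "x \<in> C3 \<psi> Z" using sup psi_subset by blast
  then obtain s where s: "\<forall>i\<in>Z. s $ i = 0" "x \<in> \<psi> s" by (auto simp: mem_C3_iff)
  then have "s = 1" using x psi_unique by blast
  then show False using s assms by auto
qed

lemma card_psi: "card (\<psi> s) = card C2"
proof -
  obtain x where x: "x \<in> \<psi> s" by (rule psi_nonempty)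
  have "x +o C2 = (+) x ` C2" by (auto simp: elt_set_plus_def)
  then show ?thesis using psi_coset[OF x] by (simp add: card_image)
qed

lemma card_C2_pos: "card C2 > 0"
  using vec.subspace_0[OF C2] by (auto simp: card_gt_0_iff)

section \<open>Joint distribution of message and codeword\<close>

context
  fixes M :: "'w measure" and S X
  assumes coding: "coset_coding M \<psi> S X"
begin

interpretation prob_space M
  using coding by (simp add: coset_coding_def)

lemma S_measurable: "S \<in> measurable M (count_space UNIV)"
  and X_measurable: "X \<in> measurable M (count_space UNIV)"
  using coding by (simp_all add: coset_coding_def)

lemma simple_function_S: "simple_function M (\<lambda>w. f (S w))"
  and simple_function_X: "simple_function M (\<lambda>w. g (X w))"
proof -
  have "simple_function M S" "simple_function M X"
    using S_measurable X_measurable by (simp_all add: simple_function_eq_measurable)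
  then show "simple_function M (\<lambda>w. f (S w))" "simple_function M (\<lambda>w. g (X w))"
    by (simp_all add: simple_function_compose1)
qed

lemma prob_S: "\<P>(w in M. S w = s) = 1 / CARD('a ^ 'l)"
proof -
  have "\<P>(w in M. S w = s) = measure (distr M (count_space UNIV) S) {s}"
    using S_measurable by (subst measure_distr) (auto intro!: arg_cong[where f = prob])
  also have "\<dots> = measure (uniform_count_measure UNIV) {s}"
    using coding by (simp add: coset_coding_def)
  also have "\<dots> = 1 / CARD('a ^ 'l)"
    by (simp add: measure_uniform_count_measure)
  finally show ?thesis .
qed

text \<open>All cosets have the size of \<open>C2\<close>, so the pair \<open>(S, X)\<close> is
  uniform on the pairs \<open>(s, x)\<close> with \<open>x \<in> \<psi> s\<close>.\<close>

lemma prob_S_X: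
  "\<P>(w in M. S w = s \<and> X w = x) = indicator (\<psi> s) x / real (CARD('a ^ 'l) * card C2)"
proof -
  have "indicator (\<psi> s) x / real (card C2) = \<P>(w in M. X w = x \<bar> S w = s)"
    using coding by (simp add: coset_coding_def card_psi)
  also have "\<dots> = \<P>(w in M. S w = s \<and> X w = x) * real CARD('a ^ 'l)" (is "_ = ?r")
    unfolding cond_prob_def prob_S by (simp add: conj_commute del: CARD_vec)
  finally have "indicator (\<psi> s) x / real (card C2) = ?r" .
  moreover have "real CARD('a ^ 'l) \<noteq> 0"
    using zero_less_card_finite[where 'a = "'a ^ 'l"] by linarith
  ultimately have "\<P>(w in M. S w = s \<and> X w = x) =
      indicator (\<psi> s) x / real (card C2) / real CARD('a ^ 'l)"
    by (simp only: nonzero_mult_div_cancel_right not_False_eq_True)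
  then show ?thesis
    by (simp only: divide_divide_eq_left of_nat_mult mult.commute)
qed

text \<open>Uniformity of \<open>(S, X)\<close> turns probabilities into cardinalities, which can
  then be compared by injections.\<close>

lemma prob_event:
  "\<P>(w in M. Q (S w) (X w)) =
    real (card {(s, x). x \<in> \<psi> s \<and> Q s x}) / real (CARD('a ^ 'l) * card C2)"
proof -
  have meas: "{w \<in> space M. S w = s \<and> X w = x} \<in> events" for s x
  proof -
    have "{w \<in> space M. S w = s \<and> X w = x} = (S -` {s} \<inter> space M) \<inter> (X -` {x} \<inter> space M)"
      by auto
    then show ?thesis
      using S_measurable X_measurable by (auto intro!: sets.Int measurable_sets)
  qed
  have "{w \<in> space M. Q (S w) (X w)} =
      (\<Union>p\<in>{(s, x). Q s x}. {w \<in> space M. S w = fst p \<and> X w = snd p})"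
    by auto
  also have "prob \<dots> = (\<Sum>p\<in>{(s, x). Q s x}. \<P>(w in M. S w = fst p \<and> X w = snd p))"
    using meas by (intro finite_measure_finite_Union) (auto simp: disjoint_family_on_def)
  also have "\<dots> = (\<Sum>p\<in>{(s, x). Q s x}. indicator {(s, x). x \<in> \<psi> s} p) / real (CARD('a ^ 'l) * card C2)"
    unfolding prob_S_X sum_divide_distrib by (intro sum.cong) (auto simp: indicator_def)
  also have "(\<Sum>p\<in>{(s, x). Q s x}. indicator {(s, x). x \<in> \<psi> s} p) =
      real (card {(s, x). x \<in> \<psi> s \<and> Q s x})"
    by (auto simp: indicator_def intro!: arg_cong[where f = card])
  finally show ?thesis .
qed

lemma prob_event_pos:
  assumes "x \<in> \<psi> s" "Q s x"
  shows "\<P>(w in M. Q (S w) (X w)) > 0"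
proof -
  have "card {(s, x). x \<in> \<psi> s \<and> Q s x} > 0"
    using assms by (auto simp: card_gt_0_iff)
  then show ?thesis
    using card_C2_pos unfolding prob_event by (simp add: zero_less_divide_iff del: CARD_vec) 
qed

text \<open>Adding to a pair \<open>(s, x)\<close> a pair \<open>(s', x')\<close> with \<open>B x' = 0\<close> moves \<open>S\<^sub>Z\<close> to any prescribed value
  without changing \<open>B X\<close>; such pairs exist because \<open>B\<close> maps \<open>C3\<close> onto the image of \<open>C1\<close>.\<close>

lemma prob_shift_le:
  assumes sub: "mat_app B ` C1 \<subseteq> mat_app B ` C3 \<psi> Z"
  shows "\<P>(w in M. (\<lambda>i\<in>Z. S w $ i) = (\<lambda>i\<in>Z. a $ i) \<and> mat_app B (X w) = v) \<le>
    \<P>(w in M. (\<lambda>i\<in>Z. S w $ i) = (\<lambda>i\<in>Z. b $ i) \<and> mat_app B (X w) = v)"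
proof -
  obtain x where x: "x \<in> \<psi> (b - a)" by (rule psi_nonempty)
  then have "mat_app B x \<in> mat_app B ` C3 \<psi> Z" using psi_subset sub by blast
  then obtain c t where c: "mat_app B x = mat_app B c" "c \<in> \<psi> t" "\<forall>i\<in>Z. t $ i = 0"
    by (auto simp: mem_C3_iff)
  \<comment> \<open>On \<open>Z\<close> this agrees with \<open>b - a\<close>, because
    \<open>t\<close> vanishes there; subtracting \<open>c\<close> from \<open>x\<close> makes the
    matching codeword shift vanish under \<open>B\<close>.\<close>
  define s' where "s' = b - a - t"
  define x' where "x' = x - c"
  have x': "x' \<in> \<psi> s'" using x c by (simp add: x'_def s'_def psi_diff)
  have B: "mat_app B (y + x') = mat_app B y" for y
    using c(1) by (simp add: mat_app_eq_iff x'_def)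
  define E where "E a = {(s, x). x \<in> \<psi> s \<and> (\<lambda>i\<in>Z. s $ i) = (\<lambda>i\<in>Z. a $ i) \<and> mat_app B x = v}"
    for a :: "'a ^ 'l"
  have "(\<lambda>p. p + (s', x')) ` E a \<subseteq> E b"
  proof
    fix p assume "p \<in> (\<lambda>p. p + (s', x')) ` E a"
    then obtain s x where sx: "(s, x) \<in> E a" and p: "p = (s, x) + (s', x')"
      by auto
    then have eq: "(\<lambda>i\<in>Z. s $ i) = (\<lambda>i\<in>Z. a $ i)" by (simp add: E_def)
    have "s $ i = a $ i" if "i \<in> Z" for i
      using fun_cong[OF eq, of i] that by (simp only: restrict_apply')
    then have "(\<lambda>i\<in>Z. (s + s') $ i) = (\<lambda>i\<in>Z. b $ i)"
      using c(3) by (auto simp: s'_def restrict_def)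
    then show "p \<in> E b"
      using sx x' by (simp add: p E_def B psi_add del: vector_add_component)
  qed
  moreover have "inj_on (\<lambda>p. p + (s', x')) (E a)" by (rule inj_onI) simp
  ultimately have "card (E a) \<le> card (E b)"
    by (intro card_inj_on_le[of "\<lambda>p. p + (s', x')"]) auto
  then show ?thesis
    unfolding E_def
      prob_event[of "\<lambda>s x. (\<lambda>i\<in>Z. s $ i) = (\<lambda>i\<in>Z. c $ i) \<and> mat_app B x = v" for c]
    by (intro divide_right_mono) simp_all
qed

text \<open>If \<open>B\<close> maps \<open>C3 \<psi> Z\<close> onto the image of \<open>C1\<close>,
  shifting shows that the joint probabilities do not depend on the value of
  \<open>S\<^sub>Z\<close>. Conversely, \<open>S\<^sub>Z = 0\<close> and \<open>B X = v\<close> each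
  have positive probability, so under independence they occur together, and any such codeword is a
  preimage of \<open>v\<close> in \<open>C3 \<psi> Z\<close>.\<close>

lemma mutual_info_coset_eq_0_iff:
  "mutual_info (real CARD('a)) M (\<lambda>w. \<lambda>i\<in>Z. S w $ i) (\<lambda>w. mat_app B (X w)) = 0 \<longleftrightarrow>
    mat_app B ` C1 \<subseteq> mat_app B ` C3 \<psi> Z"
    (is "mutual_info _ _ ?U ?V = 0 \<longleftrightarrow> _")
proof -
  have "card {0 :: 'a, 1} \<le> CARD('a)" by (intro card_mono) auto
  then have base: "real CARD('a) > 1" by simp
  note simple = simple_function_S[of "\<lambda>s. \<lambda>i\<in>Z. s $ i"] simple_function_X[of "mat_app B"]
  note iff = mutual_info_eq_0_iff[OF prob_space_axioms base simple]
  show ?thesis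
  proof
    assume sub: "mat_app B ` C1 \<subseteq> mat_app B ` C3 \<psi> Z"
    show "mutual_info (real CARD('a)) M ?U ?V = 0"
      unfolding iff
    proof (intro ballI)
      fix u v assume u: "u \<in> ?U ` space M"
      show "\<P>(w in M. ?U w = u \<and> ?V w = v) = \<P>(w in M. ?U w = u) * \<P>(w in M. ?V w = v)"
        \<comment> \<open>Equality of the joint probabilities comes from the shift inequality with
          the two values in either order.\<close>
        by (rule indep_if_joint_prob_const[OF simple _ u])
          (auto intro!: antisym prob_shift_le[OF sub])
    qed
  next
    assume MI: "mutual_info (real CARD('a)) M ?U ?V = 0"
    show "mat_app B ` C1 \<subseteq> mat_app B ` C3 \<psi> Z"
    proof
      fix v assume "v \<in> mat_app B ` C1"
      then obtain x where x: "x \<in> C1" "v = mat_app B x" by blast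
      obtain s where s: "x \<in> \<psi> s" using psi_cover x by blast
      obtain y where y: "y \<in> \<psi> 0" by (rule psi_nonempty)
      define u where "u = (\<lambda>i\<in>Z. (0 :: 'a ^ 'l) $ i)"
      have pos: "\<P>(w in M. ?U w = u) > 0" "\<P>(w in M. ?V w = v) > 0"
        using prob_event_pos[of y 0 "\<lambda>s _. (\<lambda>i\<in>Z. s $ i) = u"] y
          prob_event_pos[of x s "\<lambda>_ x. mat_app B x = v"] s x by (simp_all add: u_def)
      have "u \<in> ?U ` space M"
      proof (rule ccontr)
        assume "u \<notin> ?U ` space M"
        then have "{w \<in> space M. ?U w = u} = {}" by blast
        then show False using pos(1) by (simp only: measure_empty less_irrefl)
      qed
      moreover have "v \<in> ?V ` space M"
      proof (rule ccontr)
        assume "v \<notin> ?V ` space M"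
        then have "{w \<in> space M. ?V w = v} = {}" by blast
        then show False using pos(2) by (simp only: measure_empty less_irrefl)
      qed
      ultimately have "\<P>(w in M. ?U w = u \<and> ?V w = v) = \<P>(w in M. ?U w = u) * \<P>(w in M. ?V w = v)"
        using MI[unfolded iff] by blast
      then have "\<P>(w in M. ?U w = u \<and> ?V w = v) > 0"
        using pos by (simp only: mult_pos_pos)
      then have "{(s, x). x \<in> \<psi> s \<and> (\<lambda>i\<in>Z. s $ i) = u \<and> mat_app B x = v} \<noteq> {}"
        unfolding prob_event[of "\<lambda>s x. (\<lambda>i\<in>Z. s $ i) = u \<and> mat_app B x = v"]
        by (metis card.empty div_0 less_irrefl of_nat_0)
      then obtain t z where t: "z \<in> \<psi> t" "(\<lambda>i\<in>Z. t $ i) = u" "mat_app B z = v" by auto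
      have "t $ i = 0" if "i \<in> Z" for i
        using that fun_cong[OF t(2), of i] by (simp only: u_def restrict_apply' zero_index)
      then have "z \<in> C3 \<psi> Z" using t by (auto simp: mem_C3_iff)
      then show "v \<in> mat_app B ` C3 \<psi> Z" using t by blast
    qed
  qed
qed

end

end

section \<open>The first relative weight and the strength formula\<close>

text \<open>For nested subspaces a dimension gap of at least 1 inside \<open>V\<close> means that
  the two intersections with \<open>V\<close> differ. The minimum is then bounded by
  \<open>r\<close> iff some admissible space is.\<close>

lemma RGRW_1_le_iff:
  fixes K :: "'a::{field,finite} set" and D1 D2 :: "('a ^ 'n) set"
  assumes K: "is_subfield K" and D1: "vec.subspace D1" and D2: "vec.subspace D2"
    and sub: "D2 \<subseteq> D1" and neq: "\<not> D1 \<subseteq> D2"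
  shows "RGRW (card K) 1 D1 D2 \<le> r \<longleftrightarrow>
    (\<exists>V\<in>Gamma (card K). vec.dim V \<le> r \<and> \<not> D1 \<inter> V \<subseteq> D2)"
proof -
  have dim: "int (vec.dim (D1 \<inter> V)) - int (vec.dim (D2 \<inter> V)) \<ge> int 1 \<longleftrightarrow> \<not> D1 \<inter> V \<subseteq> D2"
    if "V \<in> Gamma (card K)" for V
  proof -
    have V: "vec.subspace V" using that by (simp add: Gamma_def)
    have "vec.dim (D2 \<inter> V) \<le> vec.dim (D1 \<inter> V)"
      using sub by (intro vec.dim_subset) auto
    moreover have "D2 \<inter> V = D1 \<inter> V" if "vec.dim (D2 \<inter> V) = vec.dim (D1 \<inter> V)"
      using that D1 D2 V sub by (intro vec.subspace_dim_equal vec.subspace_inter) auto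
    then have "vec.dim (D2 \<inter> V) = vec.dim (D1 \<inter> V) \<longleftrightarrow> D2 \<inter> V = D1 \<inter> V" by metis
    ultimately show ?thesis using sub by auto
  qed
  define A where "A = {vec.dim V | V. V \<in> Gamma (card K) \<and>
     int (vec.dim (D1 \<inter> V)) - int (vec.dim (D2 \<inter> V)) \<ge> int 1}"
  have A: "A = vec.dim ` {V \<in> Gamma (card K). \<not> D1 \<inter> V \<subseteq> D2}"
    unfolding A_def using dim by blast
  \<comment> \<open>The whole space is admissible because \<open>D1\<close> is not contained in
    \<open>D2\<close>, so the minimum is over a nonempty set.\<close>
  have "(UNIV :: ('a ^ 'n) set) \<in> Gamma (card K)"
    by (rule mem_GammaI[OF K]) (simp_all add: vec.subspace_UNIV)
  then have "A \<noteq> {}" using neq by (auto simp: A)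
  moreover have "finite A" by (simp add: A)
  ultimately have "Min A \<le> r \<longleftrightarrow> (\<exists>d\<in>A. d \<le> r)" by (rule Min_le_iff[rotated])
  then show ?thesis unfolding RGRW_def A_def[symmetric] by (auto simp: A)
qed

theorem theorem31:
  fixes Fq :: "'a::{field,finite} set" and q m :: nat
    and C1 C2 :: "('a ^ 'n) set"
    and \<psi> :: "'a ^ 'l \<Rightarrow> ('a ^ 'n) set"
    and M :: "'w measure" and S :: "'w \<Rightarrow> 'a ^ 'l" and X :: "'w \<Rightarrow> 'a ^ 'n"
  assumes "is_subfield Fq" and "card Fq = q"
    and "m \<ge> 1" and "CARD('a) = q ^ m"
    and "vec.subspace C1" and "vec.subspace C2" and "C2 \<subset> C1"
    and "int (vec.dim C2) = int (vec.dim C1) - int CARD('l)"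
    and "linear_bij_quotient C1 C2 \<psi>"
    and "coset_coding M \<psi> S X"
  shows "universal_maximum_strength Fq M S X =
    int (Min {RGRW q 1 (dual_code (C3 \<psi> Z)) (dual_code C1) + card Z | Z. Z \<noteq> {}}) - 2"
proof -
  interpret coset_scheme C1 C2 \<psi>
    using assms by unfold_locales auto
  note K = assms(1)
  define R where "R Z = RGRW q 1 (dual_code (C3 \<psi> Z)) (dual_code C1)" for Z
  have R_le_iff: "R Z \<le> r \<longleftrightarrow>
      (\<exists>B\<in>matrices Fq r. \<not> dual_code (C3 \<psi> Z) \<inter> vec.span (set B) \<subseteq> dual_code C1)"
    if "Z \<noteq> {}" for Z r
  proof -
    \<comment> \<open>Otherwise a second dualization would place \<open>C1\<close> inside
      \<open>C3 \<psi> Z\<close>.\<close>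
    have "\<not> dual_code (C3 \<psi> Z) \<subseteq> dual_code C1"
      using dual_code_antimono[of "dual_code (C3 \<psi> Z)" "dual_code C1"] C3_not_superset[OF that]
      by (auto simp: dual_dual_code subspace_C3 C1)
    then have iff: "R Z \<le> r \<longleftrightarrow> (\<exists>V\<in>Gamma q. vec.dim V \<le> r \<and>
        \<not> dual_code (C3 \<psi> Z) \<inter> V \<subseteq> dual_code C1)"
      unfolding R_def assms(2)[symmetric]
      by (intro RGRW_1_le_iff[OF K] subspace_dual_code dual_code_antimono C3_subset)
    have "vec.span (set B) \<in> Gamma q \<and> vec.dim (vec.span (set B)) \<le> r" if "B \<in> matrices Fq r" for B
    proof
      show "vec.span (set B) \<in> Gamma q"
        using span_mem_Gamma[OF K, of "set B"] that assms(2)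
        by (auto simp: matrices_def vectors_over_def)
      have "vec.dim (set B) \<le> card (set B)"
        by (intro vec.dim_le_card') simp
      also have "\<dots> \<le> r" using that card_length[of B] by (simp add: matrices_def)
      finally show "vec.dim (vec.span (set B)) \<le> r" by (simp add: vec.dim_span)
    qed
    moreover have "\<exists>B\<in>matrices Fq r. vec.span (set B) = V" if "V \<in> Gamma q" "vec.dim V \<le> r" for V
      using Gamma_rows[OF K] that assms(2) by metis
    ultimately show ?thesis unfolding iff by metis
  qed
  \<comment> \<open>A matrix without rows spans only the zero space, which lies in every dual code
    and so reveals nothing.\<close>
  have R_pos: "R Z > 0" if "Z \<noteq> {}" for Z
  proof (rule ccontr)
    assume "\<not> R Z > 0"
    then have "R Z \<le> 0" by simp
    then show False
      using R_le_iff[OF that, of 0] vec.subspace_0[OF subspace_dual_code]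
      by (auto simp: matrices_def)
  qed
  have MI: "mutual_info (real CARD('a)) M (\<lambda>w. \<lambda>i\<in>Z. S w $ i) (\<lambda>w. mat_app B (X w)) = 0 \<longleftrightarrow>
      dual_code (C3 \<psi> Z) \<inter> vec.span (set B) \<subseteq> dual_code C1" for Z B
    by (simp only: mutual_info_coset_eq_0_iff[OF assms(10)] mat_app_image_subset_iff[OF subspace_C3])
  \<comment> \<open>Security for \<open>Z\<close> means fewer than \<open>R Z\<close> rows:
    \<open>\<omega> - card Z + 1 \<le> R Z - 1\<close>, which is the source of the 2. If the number
    of rows is not positive, the bound still holds because \<open>R Z\<close> is at least 1.\<close>
  have secure: "secure_at Fq M S X \<omega> \<longleftrightarrow> (\<forall>Z. Z \<noteq> {} \<longrightarrow> \<omega> + 2 \<le> int (R Z + card Z))" for \<omega>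
  proof -
    have "(\<omega> - int (card Z) + 1 > 0 \<longrightarrow> (\<forall>B\<in>matrices Fq (nat (\<omega> - int (card Z) + 1)).
        mutual_info (real CARD('a)) M (\<lambda>w. \<lambda>i\<in>Z. S w $ i) (\<lambda>w. mat_app B (X w)) = 0)) \<longleftrightarrow>
      (Z \<noteq> {} \<longrightarrow> \<omega> + 2 \<le> int (R Z + card Z))" for Z
    proof (cases "Z = {}")
      case True
      then show ?thesis by (auto simp: MI C3_empty)
    next
      case False
      have "(\<forall>B\<in>matrices Fq r. mutual_info (real CARD('a)) M (\<lambda>w. \<lambda>i\<in>Z. S w $ i)
          (\<lambda>w. mat_app B (X w)) = 0) \<longleftrightarrow> r < R Z" for r
        using R_le_iff[OF False, of r] unfolding MI by (meson not_le)
      then show ?thesis using False R_pos[OF False] by simp linarith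
    qed
    then show ?thesis unfolding secure_at_def by meson
  qed
  define A where "A = {R Z + card Z | Z. Z \<noteq> {}}"
  have A: "A = (\<lambda>Z. R Z + card Z) ` {Z. Z \<noteq> {}}" by (auto simp: A_def)
  have "finite A" by (simp add: A)
  moreover have "A \<noteq> {}" by (auto simp: A)
  ultimately have "secure_at Fq M S X \<omega> \<longleftrightarrow> \<omega> \<le> int (Min A) - 2" for \<omega>
  proof -
    \<comment> \<open>A negative \<open>\<omega> + 2\<close> is truncated to 0 by
      \<open>nat\<close>, which is harmless since the elements of \<open>A\<close> are natural
      numbers.\<close>
    have "secure_at Fq M S X \<omega> \<longleftrightarrow> (\<forall>a\<in>A. nat (\<omega> + 2) \<le> a)"
      unfolding secure A by auto
    also have "\<dots> \<longleftrightarrow> nat (\<omega> + 2) \<le> Min A"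
      using \<open>finite A\<close> \<open>A \<noteq> {}\<close> by simp
    finally show ?thesis by linarith
  qed
  then have "universal_maximum_strength Fq M S X = int (Min A) - 2"
    unfolding universal_maximum_strength_def by (intro Greatest_equality) simp_all
  then show ?thesis by (simp only: A_def R_def)
qed

end
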